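(* Let $S$ be a connected graph. Then every connected $S$-free graph $G$ satisfies $\kappa'(G)=\delta(G)$ if and only if $S$ is an induced subgraph of $P_4$.
   Context: All graphs are finite and simple. A graph $G$ is $S$-free if $G$ contains no induced subgraph isomorphic to $S$. $\kappa'(G)$ denotes the edge-connectivity of $G$ (minimum number of edges whose removal disconnects $G$) and $\delta(G)$ its minimum degree. $P_i$ denotes the path with $i$ vertices. *)

theory Defs
  imports "Graph_Theory.Graph_Theory" "HOL-Library.Infinite_Typeclass"
begin

text \<open>
  Finite simple graphs are the \<^locale>\<open>pair_graph\<close>s of the library: an undirected edge between
  \<open>u\<close> and \<open>v\<close> is the pair of opposite arcs \<open>(u,v)\<close>, \<open>(v,u)\<close>. The library allows the null graph
  as a \<^locale>\<open>pair_graph\<close>, but \<^const>\<open>Digraph_Component.connected\<close> requires a vertex.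
\<close>

text \<open>
  \<open>S\<close> is, up to isomorphism, an induced subgraph of \<open>G\<close>; the two vertex types may differ.
\<close>
definition is_induced_subgraph_of :: "'a pair_pre_digraph \<Rightarrow> 'b pair_pre_digraph \<Rightarrow> bool" where
  "is_induced_subgraph_of S G \<longleftrightarrow>
     (\<exists>H :: 'b pair_pre_digraph.
        induced_subgraph (with_proj H) (with_proj G) \<and> digraph_iso (with_proj S) (with_proj H))"

definition induced_free :: "'a pair_pre_digraph \<Rightarrow> 'b pair_pre_digraph \<Rightarrow> bool" where
  "induced_free S G \<longleftrightarrow> \<not> is_induced_subgraph_of S G"

text \<open>The out-degree of a vertex of a \<^locale>\<open>pair_graph\<close> is its number of neighbours.\<close>
definition min_degree :: "'a pair_pre_digraph \<Rightarrow> nat" where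
  "min_degree G = Min (out_degree (with_proj G) ` pverts G)"

definition uedges :: "'a pair_pre_digraph \<Rightarrow> 'a set set" where
  "uedges G = (\<lambda>(u, v). {u, v}) ` parcs G"

definition del_uedges :: "'a pair_pre_digraph \<Rightarrow> 'a set set \<Rightarrow> 'a pair_pre_digraph" where
  "del_uedges G F = \<lparr> pverts = pverts G, parcs = {(u, v). (u, v) \<in> parcs G \<and> {u, v} \<notin> F} \<rparr>"

text \<open>
  Edges are counted as unordered pairs, so that the two arcs of an edge count once. A graph with
  a single vertex cannot be disconnected; its edge-connectivity is \<open>0\<close> by the usual convention.
\<close>
definition edge_connectivity :: "'a pair_pre_digraph \<Rightarrow> nat" where
  "edge_connectivity G =
     (if card (pverts G) \<le> 1 then 0
      else Min {card F | F. F \<subseteq> uedges G \<and> \<not> connected (with_proj (del_uedges G F))})"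

definition path_graph :: "nat \<Rightarrow> nat pair_pre_digraph" where
  "path_graph n =
     \<lparr> pverts = {..<n}, parcs = {(i, j). i < n \<and> j < n \<and> (j = Suc i \<or> i = Suc j)} \<rparr>"

end

theory Submission
  imports Defs
begin

text \<open>
  If \<open>S\<close> embeds into \<open>P\<^sub>4\<close>, an \<open>S\<close>-free connected graph has no induced \<open>P\<^sub>4\<close>, hence diameter at most 2.
  Across any edge cut one side then has all its vertices incident with the cut, and the neighbours
  of any vertex of that side inject into the cut, so the cut has at least \<open>\<delta>\<close> edges (Plesnik).
  Conversely, two triangles joined by a bridge and two 4-cycles joined by a bridge both have
  \<open>\<kappa>' = 1 < 2 = \<delta>\<close>, so \<open>S\<close> embeds into both. The second graph is bipartite, so \<open>S\<close> is triangle-free,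
  and the triangle-free connected induced subgraphs of the first one all embed into \<open>P\<^sub>4\<close>.
\<close>

section \<open>Induced subgraphs\<close>

text \<open>An arc of a pair digraph is the pair of its ends, so the arc component of an isomorphism
  is forced by its vertex component. The rest of the development can therefore work with injective
  vertex maps that preserve and reflect adjacency.\<close>

lemma is_induced_subgraph_of_iff:
  assumes S: "pair_graph S" and G: "pair_graph G"
  shows "is_induced_subgraph_of S G \<longleftrightarrow>
    (\<exists>f. inj_on f (pverts S) \<and> f ` pverts S \<subseteq> pverts G \<and>
      (\<forall>u\<in>pverts S. \<forall>v\<in>pverts S. (u, v) \<in> parcs S \<longleftrightarrow> (f u, f v) \<in> parcs G))"
    (is "_ \<longleftrightarrow> (\<exists>f. ?emb f)")
proof
  interpret S: pair_graph S by (rule S)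
  assume "is_induced_subgraph_of S G"
  then obtain H where H: "induced_subgraph (with_proj H) (with_proj G)"
    and iso: "digraph_iso (with_proj S) (with_proj H)"
    unfolding is_induced_subgraph_of_def by blast
  from iso obtain h where h: "S.digraph_isomorphism h" and Hh: "with_proj H = app_iso h (with_proj S)"
    unfolding digraph_iso_def by blast
  let ?f = "iso_verts h"
  \<comment> \<open>The record equation is compared field by field. Tail and head of
    \<open>with_proj H\<close> are the projections, so \<open>iso_tail h\<close> and
    \<open>iso_head h\<close> must be \<open>fst\<close> and \<open>snd\<close>.\<close>
  have vH: "pverts H = ?f ` pverts S" and aH: "parcs H = iso_arcs h ` parcs S"
    and tH: "iso_tail h = fst" and hH: "iso_head h = snd"
    using arg_cong[OF Hh, of verts] arg_cong[OF Hh, of arcs] arg_cong[OF Hh, of tail]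
      arg_cong[OF Hh, of head] by (auto simp: app_iso_def)
  have inj: "inj_on ?f (pverts S)"
    using h by (simp add: S.digraph_isomorphism_def)
  have arc: "iso_arcs h (u, v) = (?f u, ?f v)" if "(u, v) \<in> parcs S" for u v
    using h that tH hH by (metis S.digraph_isomorphism_def fst_conv snd_conv prod.collapse)
  have sub: "pverts H \<subseteq> pverts G"
    and arcsH: "parcs H = {e \<in> parcs G. fst e \<in> pverts H \<and> snd e \<in> pverts H}"
    using H by (auto simp: induced_subgraph_def subgraph_def)
  have "(u, v) \<in> parcs S \<longleftrightarrow> (?f u, ?f v) \<in> parcs G" if "u \<in> pverts S" "v \<in> pverts S" for u v
  proof
    assume "(u, v) \<in> parcs S"
    then show "(?f u, ?f v) \<in> parcs G"
      using arc aH arcsH by (metis (no_types, lifting) image_eqI mem_Collect_eq)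
  next
    assume "(?f u, ?f v) \<in> parcs G"
    then have "(?f u, ?f v) \<in> parcs H"
      using that arcsH vH by auto
    then obtain x y where xy: "(x, y) \<in> parcs S" "(?f u, ?f v) = iso_arcs h (x, y)"
      using aH by auto
    then have "?f u = ?f x" "?f v = ?f y"
      using arc by auto
    then show "(u, v) \<in> parcs S"
      using xy that S.wellformed' inj by (metis inj_onD)
  qed
  then show "\<exists>f. ?emb f"
    using inj sub vH by auto
next
  interpret S: pair_graph S by (rule S)
  interpret G: pair_graph G by (rule G)
  assume "\<exists>f. ?emb f"
  then obtain f where inj: "inj_on f (pverts S)" and ran: "f ` pverts S \<subseteq> pverts G"
    and adj: "\<And>u v. u \<in> pverts S \<Longrightarrow> v \<in> pverts S \<Longrightarrow> (u, v) \<in> parcs S \<longleftrightarrow> (f u, f v) \<in> parcs G"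
    by blast
  define H where "H = \<lparr> pverts = f ` pverts S, parcs = map_prod f f ` parcs S \<rparr>"
  define h where "h = \<lparr> iso_verts = f, iso_arcs = map_prod f f, iso_head = snd, iso_tail = fst \<rparr>"
  have wfH: "pair_wf_digraph H"
    using S.wellformed' by unfold_locales (auto simp: H_def)
  have "parcs H = {e \<in> parcs G. fst e \<in> pverts H \<and> snd e \<in> pverts H}"
  proof (intro equalityI subsetI)
    fix e assume "e \<in> parcs H"
    then obtain u v where "(u, v) \<in> parcs S" "e = (f u, f v)"
      by (auto simp: H_def)
    then show "e \<in> {e \<in> parcs G. fst e \<in> pverts H \<and> snd e \<in> pverts H}"
      using S.wellformed'[of u v] adj by (simp add: H_def)
  next
    fix e assume "e \<in> {e \<in> parcs G. fst e \<in> pverts H \<and> snd e \<in> pverts H}"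
    then obtain u v where uv: "u \<in> pverts S" "v \<in> pverts S" "e = (f u, f v)" "e \<in> parcs G"
      by (cases e) (auto simp: H_def)
    then have "(u, v) \<in> parcs S"
      using adj by simp
    then show "e \<in> parcs H"
      using uv by (force simp: H_def)
  qed
  moreover have "pverts H \<subseteq> pverts G"
    using ran by (simp add: H_def)
  ultimately have "induced_subgraph (with_proj H) (with_proj G)"
    using wfH G.wf_digraph
    by (auto simp: induced_subgraph_def subgraph_def compatible_def wf_digraph_wp_iff)
  moreover have "inj_on (map_prod f f) (parcs S)"
    using inj S.wellformed' by (auto simp: inj_on_def)
  then have "S.digraph_isomorphism h"
    using inj S.wf_digraph by (auto simp: S.digraph_isomorphism_def h_def)
  moreover have "with_proj H = app_iso h (with_proj S)"
    by (simp add: app_iso_def h_def H_def with_proj_def)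
  ultimately show "is_induced_subgraph_of S G"
    unfolding is_induced_subgraph_of_def digraph_iso_def by blast
qed

lemma is_induced_subgraph_of_trans:
  assumes "pair_graph S" "pair_graph P" "pair_graph G"
    and "is_induced_subgraph_of S P" "is_induced_subgraph_of P G"
  shows "is_induced_subgraph_of S G"
proof -
  obtain f where f: "inj_on f (pverts S)" "f ` pverts S \<subseteq> pverts P"
    "\<forall>u\<in>pverts S. \<forall>v\<in>pverts S. (u, v) \<in> parcs S \<longleftrightarrow> (f u, f v) \<in> parcs P"
    using assms by (auto simp: is_induced_subgraph_of_iff)
  obtain g where g: "inj_on g (pverts P)" "g ` pverts P \<subseteq> pverts G"
    "\<forall>u\<in>pverts P. \<forall>v\<in>pverts P. (u, v) \<in> parcs P \<longleftrightarrow> (g u, g v) \<in> parcs G"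
    using assms by (auto simp: is_induced_subgraph_of_iff)
  have "inj_on (g \<circ> f) (pverts S)"
    using f g by (meson comp_inj_on inj_on_subset)
  moreover have "(g \<circ> f) ` pverts S \<subseteq> pverts G"
    using f(2) g(2) by (auto simp: image_subset_iff)
  moreover have "\<forall>u\<in>pverts S. \<forall>v\<in>pverts S. (u, v) \<in> parcs S \<longleftrightarrow> ((g \<circ> f) u, (g \<circ> f) v) \<in> parcs G"
    using f g by (auto simp: image_subset_iff)
  ultimately show ?thesis
    using assms(1,3) is_induced_subgraph_of_iff by blast
qed

section \<open>Connectedness, cuts and degrees\<close>

text \<open>A walk that starts in \<open>A\<close> and ends outside must use an arc leaving
  \<open>A\<close>; conversely, the set reachable from a vertex has no leaving arc. This form of
  connectedness speaks directly of cuts.\<close>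

lemma (in pair_sym_digraph) connected_iff_cut:
  "connected (with_proj G) \<longleftrightarrow> pverts G \<noteq> {} \<and>
    (\<forall>A \<subseteq> pverts G. A \<noteq> {} \<longrightarrow> A \<noteq> pverts G \<longrightarrow> (\<exists>a\<in>A. \<exists>b\<in>pverts G - A. (a, b) \<in> parcs G))"
proof -
  \<comment> \<open>The library defines connectedness as strong connectedness of the symmetric
    closure; the arcs are symmetric already, so reachability is unchanged.\<close>
  have conn: "connected (with_proj G) \<longleftrightarrow>
    pverts G \<noteq> {} \<and> (\<forall>u\<in>pverts G. \<forall>v\<in>pverts G. u \<rightarrow>\<^sup>*\<^bsub>with_proj G\<^esub> v)"
    unfolding connected_def strongly_connected_def
    using reachable_mk_symmetric_eq[OF pair_sym_arcs] by simp
  show ?thesis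
  proof (intro iffI conjI allI impI)
    assume c: "connected (with_proj G)"
    then show "pverts G \<noteq> {}" using conn by blast
    fix A assume A: "A \<subseteq> pverts G" "A \<noteq> {}" "A \<noteq> pverts G"
    then obtain u v where uv: "u \<in> A" "v \<in> pverts G" "v \<notin> A" by blast
    then have r: "u \<rightarrow>\<^sup>*\<^bsub>with_proj G\<^esub> v" using conn c A by blast
    show "\<exists>a\<in>A. \<exists>b\<in>pverts G - A. (a, b) \<in> parcs G"
    proof (rule ccontr)
      assume *: "\<not> ?thesis"
      from r have "v \<in> A"
      proof (induction rule: reachable_induct)
        case base show ?case by (rule uv)
      next
        case (step x y)
        then show ?case using * in_arcsD2[OF step(2)] by blast
      qed
      with uv show False by blast
    qed
  next
    assume *: "pverts G \<noteq> {} \<and> (\<forall>A \<subseteq> pverts G. A \<noteq> {} \<longrightarrow> A \<noteq> pverts G \<longrightarrow>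
      (\<exists>a\<in>A. \<exists>b\<in>pverts G - A. (a, b) \<in> parcs G))"
    have "u \<rightarrow>\<^sup>*\<^bsub>with_proj G\<^esub> v" if u: "u \<in> pverts G" and v: "v \<in> pverts G" for u v
    proof (rule ccontr)
      assume n: "\<not> u \<rightarrow>\<^sup>*\<^bsub>with_proj G\<^esub> v"
      define A where "A = {w \<in> pverts G. u \<rightarrow>\<^sup>*\<^bsub>with_proj G\<^esub> w}"
      have "A \<subseteq> pverts G" "A \<noteq> {}" "A \<noteq> pverts G"
        using u v n by (auto simp: A_def)
      then obtain a b where "a \<in> A" "b \<in> pverts G - A" "(a, b) \<in> parcs G"
        using * by blast
      then show False
        using reachable_adj_trans[of u a b] by (auto simp: A_def)
    qed
    then show "connected (with_proj G)" using conn * by blast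
  qed
qed

lemma out_degree_eq_card_neighbours:
  "out_degree (with_proj G) x = card {v. (x, v) \<in> parcs G}"
proof -
  have "out_arcs (with_proj G) x = Pair x ` {v. (x, v) \<in> parcs G}"
    by (auto simp: out_arcs_def)
  then show ?thesis
    by (simp add: out_degree_def card_image inj_on_def)
qed

context pair_graph
begin

lemma arc_sym: "(u, v) \<in> parcs G \<Longrightarrow> (v, u) \<in> parcs G"
  using pair_sym_arcs by (auto simp: symmetric_def dest: symD)

lemma finite_uedges: "finite (uedges G)"
  by (simp add: uedges_def pair_finite_arcs)

lemma finite_neighbours: "finite {v. (x, v) \<in> parcs G}"
  by (rule finite_subset[OF _ pair_finite_verts]) (auto dest: wellformed')

lemma doubleton_in_uedges_iff: "{u, v} \<in> uedges G \<longleftrightarrow> (u, v) \<in> parcs G"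
proof
  assume "{u, v} \<in> uedges G"
  then show "(u, v) \<in> parcs G"
    by (auto simp: uedges_def doubleton_eq_iff intro: arc_sym)
next
  assume "(u, v) \<in> parcs G"
  then show "{u, v} \<in> uedges G"
    unfolding uedges_def by (rule rev_image_eqI) simp
qed

text \<open>This is the cut criterion for the remaining graph: an arc from \<open>A\<close> to its
  complement survives the deletion exactly if its edge is outside \<open>F\<close>.\<close>

lemma del_uedges_disconnected_iff:
  assumes "pverts G \<noteq> {}"
  shows "\<not> connected (with_proj (del_uedges G F)) \<longleftrightarrow>
    (\<exists>A \<subseteq> pverts G. A \<noteq> {} \<and> A \<noteq> pverts G \<and>
      (\<forall>a\<in>A. \<forall>b\<in>pverts G - A. (a, b) \<in> parcs G \<longrightarrow> {a, b} \<in> F))"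
proof -
  interpret D: pair_sym_digraph "del_uedges G F"
    by unfold_locales
      (auto simp: del_uedges_def symmetric_def sym_def insert_commute dest: wellformed' intro: arc_sym)
  show ?thesis
    using assms unfolding D.connected_iff_cut by (simp add: del_uedges_def)
qed

lemma edge_connectivity_le:
  assumes "F \<subseteq> uedges G" "A \<subseteq> pverts G" "A \<noteq> {}" "A \<noteq> pverts G"
    and "\<And>a b. a \<in> A \<Longrightarrow> b \<in> pverts G - A \<Longrightarrow> (a, b) \<in> parcs G \<Longrightarrow> {a, b} \<in> F"
  shows "edge_connectivity G \<le> card F"
proof (cases "card (pverts G) \<le> 1")
  case True
  then show ?thesis by (simp add: edge_connectivity_def)
next
  case False
  have "pverts G \<noteq> {}" using assms by blast
  then have "\<not> connected (with_proj (del_uedges G F))"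
    using assms unfolding del_uedges_disconnected_iff[OF \<open>pverts G \<noteq> {}\<close>] by blast
  then have "card F \<in> {card F | F. F \<subseteq> uedges G \<and> \<not> connected (with_proj (del_uedges G F))}"
    using assms(1) by blast
  moreover have "finite {card F | F. F \<subseteq> uedges G \<and> \<not> connected (with_proj (del_uedges G F))}"
    using finite_uedges by simp
  ultimately show ?thesis
    using False by (simp add: edge_connectivity_def)
qed

text \<open>The minimum in the definition is attained, and a minimum disconnecting edge set comes
  with a vertex set all of whose leaving edges it contains.\<close>

lemma edge_connectivity_witness:
  assumes "1 < card (pverts G)"
  obtains F A where "F \<subseteq> uedges G" "edge_connectivity G = card F"
    "A \<subseteq> pverts G" "A \<noteq> {}" "A \<noteq> pverts G"
    "\<And>a b. a \<in> A \<Longrightarrow> b \<in> pverts G - A \<Longrightarrow> (a, b) \<in> parcs G \<Longrightarrow> {a, b} \<in> F"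
proof -
  let ?M = "{card F | F. F \<subseteq> uedges G \<and> \<not> connected (with_proj (del_uedges G F))}"
  have ne: "pverts G \<noteq> {}" using assms by auto
  obtain x where x: "x \<in> pverts G" using ne by blast
  have "{x} \<noteq> pverts G" using assms by (metis One_nat_def card_1_singleton_iff less_irrefl)
  \<comment> \<open>Without any edges \<open>x\<close> is isolated, and a second vertex exists;
    hence the minimum is taken over a nonempty set.\<close>
  then have "\<not> connected (with_proj (del_uedges G (uedges G)))"
    unfolding del_uedges_disconnected_iff[OF ne] using x
    by (intro exI[of _ "{x}"]) (auto simp: doubleton_in_uedges_iff)
  then have "?M \<noteq> {}" by blast
  moreover have "finite ?M" using finite_uedges by simp
  ultimately have "Min ?M \<in> ?M" by (rule Min_in[rotated])
  moreover have "edge_connectivity G = Min ?M"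
    using assms by (simp add: edge_connectivity_def)
  ultimately obtain F where F: "F \<subseteq> uedges G" "edge_connectivity G = card F"
    "\<not> connected (with_proj (del_uedges G F))" by auto
  then show ?thesis
    using that[OF F(1,2)] unfolding del_uedges_disconnected_iff[OF ne] by blast
qed

text \<open>The edges at a vertex of minimum degree separate it from the other vertices, if there
  are any.\<close>

lemma edge_connectivity_le_min_degree:
  assumes "pverts G \<noteq> {}"
  shows "edge_connectivity G \<le> min_degree G"
proof (cases "card (pverts G) \<le> 1")
  case True
  then show ?thesis by (simp add: edge_connectivity_def)
next
  case False
  have "min_degree G \<in> out_degree (with_proj G) ` pverts G"
    unfolding min_degree_def using assms pair_finite_verts by (intro Min_in) auto
  then obtain x where x: "x \<in> pverts G" "min_degree G = out_degree (with_proj G) x" by blast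
  define F where "F = (\<lambda>v. {x, v}) ` {v. (x, v) \<in> parcs G}"
  have "edge_connectivity G \<le> card F"
  proof (rule edge_connectivity_le[where A = "{x}"])
    show "{x} \<noteq> pverts G" using False by (metis One_nat_def card_1_singleton_iff order_refl)
  qed (use x in \<open>auto simp: F_def doubleton_in_uedges_iff\<close>)
  also have "\<dots> \<le> min_degree G"
    unfolding x(2) out_degree_eq_card_neighbours F_def using finite_neighbours by (rule card_image_le)
  finally show ?thesis .
qed

text \<open>A neighbour \<open>v\<close> of \<open>x\<close> outside \<open>A\<close> is sent to the
  cut edge between \<open>x\<close> and \<open>v\<close>, a neighbour inside \<open>A\<close> to a
  cut edge from \<open>v\<close> to a chosen outside neighbour \<open>g v\<close>. This map into
  \<open>F\<close> is injective.\<close>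

lemma out_degree_le_card_cut:
  assumes "finite F" "x \<in> A" "A \<subseteq> pverts G"
    and cut: "\<And>a b. a \<in> A \<Longrightarrow> b \<in> pverts G - A \<Longrightarrow> (a, b) \<in> parcs G \<Longrightarrow> {a, b} \<in> F"
    and nb: "\<And>a. a \<in> A \<Longrightarrow> \<exists>b\<in>pverts G - A. (a, b) \<in> parcs G"
  shows "out_degree (with_proj G) x \<le> card F"
proof -
  obtain g where g: "\<And>a. a \<in> A \<Longrightarrow> g a \<in> pverts G - A \<and> (a, g a) \<in> parcs G"
    using nb by metis
  define e where "e v = (if v \<in> A then {v, g v} else {x, v})" for v
  \<comment> \<open>The trace on \<open>A\<close> recovers an inside neighbour \<open>v\<close>, and
    \<open>v\<close> differs from \<open>x\<close>. If the trace is \<open>x\<close>, then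
    \<open>v\<close> is the other end of the edge.\<close>
  have eA: "e v \<inter> A = (if v \<in> A then {v} else {x})" for v
    using g \<open>x \<in> A\<close> by (auto simp: e_def)
  have "inj_on e {v. (x, v) \<in> parcs G}"
  proof (rule inj_onI)
    fix v w assume vw: "v \<in> {v. (x, v) \<in> parcs G}" "w \<in> {v. (x, v) \<in> parcs G}" and eq: "e v = e w"
    have "v \<noteq> x" "w \<noteq> x" using vw no_loops' by auto
    then show "v = w"
      using eq eA[of v] eA[of w] by (auto simp: e_def doubleton_eq_iff split: if_splits)
  qed
  moreover have "e ` {v. (x, v) \<in> parcs G} \<subseteq> F"
    using cut g \<open>x \<in> A\<close> by (auto simp: e_def dest: wellformed')
  ultimately show ?thesis
    unfolding out_degree_eq_card_neighbours using \<open>finite F\<close> by (rule card_inj_on_le)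
qed

end

section \<open>Graphs without induced \<open>P\<^sub>4\<close>\<close>

lemma pair_graph_path_graph: "pair_graph (path_graph n)"
proof -
  have "finite (parcs (path_graph n))"
    by (rule finite_subset[of _ "{..<n} \<times> {..<n}"]) (auto simp: path_graph_def)
  then show ?thesis
    by unfold_locales (auto simp: path_graph_def symmetric_def sym_def)
qed

lemma (in pair_graph) path_graph_4_induced:
  assumes "(a, b) \<in> parcs G" "(b, c) \<in> parcs G" "(c, d) \<in> parcs G"
    and "(a, c) \<notin> parcs G" "(a, d) \<notin> parcs G" "(b, d) \<notin> parcs G"
    and "a \<noteq> c" "a \<noteq> d" "b \<noteq> d"
  shows "is_induced_subgraph_of (path_graph 4) G"
proof -
  define f where "f = (!) [a, b, c, d]"
  have four: "{..<4::nat} = {0, 1, 2, 3}" by auto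
  have f: "f 0 = a" "f 1 = b" "f 2 = c" "f 3 = d" "f (Suc 0) = b"
    by (simp_all add: f_def)
  have ne: "a \<noteq> b" "b \<noteq> c" "c \<noteq> d" using assms no_loops' by blast+
  have sym: "(b, a) \<in> parcs G" "(c, b) \<in> parcs G" "(d, c) \<in> parcs G"
    "(c, a) \<notin> parcs G" "(d, a) \<notin> parcs G" "(d, b) \<notin> parcs G"
    using assms arc_sym by blast+
  have loop: "(v, v) \<notin> parcs G" for v using no_loops' by blast
  have "inj_on f (pverts (path_graph 4))"
    using assms ne by (auto simp: path_graph_def four f)
  moreover have "f ` pverts (path_graph 4) \<subseteq> pverts G"
    using assms by (auto simp: path_graph_def four f dest: wellformed')
  moreover have "\<forall>u\<in>pverts (path_graph 4). \<forall>v\<in>pverts (path_graph 4).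
      (u, v) \<in> parcs (path_graph 4) \<longleftrightarrow> (f u, f v) \<in> parcs G"
    using assms sym by (simp add: path_graph_def four f loop)
  ultimately show ?thesis
    using is_induced_subgraph_of_iff[OF pair_graph_path_graph pair_graph_axioms] by blast
qed

text \<open>This is the bound 2 on the diameter: an edge leaving the ball of radius 2 around
  \<open>x\<close> would complete an induced P4 that starts in \<open>x\<close>.\<close>

lemma (in pair_graph) P4_free_common_neighbour:
  assumes conn: "connected (with_proj G)" and free: "induced_free (path_graph 4) G"
    and x: "x \<in> pverts G" and y: "y \<in> pverts G" "y \<noteq> x" "(x, y) \<notin> parcs G"
  shows "\<exists>z. (x, z) \<in> parcs G \<and> (z, y) \<in> parcs G"
proof (rule ccontr)
  assume none: "\<nexists>z. (x, z) \<in> parcs G \<and> (z, y) \<in> parcs G"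
  define B where "B = {v \<in> pverts G. v = x \<or> (x, v) \<in> parcs G \<or> (\<exists>z. (x, z) \<in> parcs G \<and> (z, v) \<in> parcs G)}"
  have "y \<notin> B" "x \<in> B" "B \<subseteq> pverts G"
    using none x y by (auto simp: B_def)
  then obtain c d where cd: "c \<in> B" "d \<in> pverts G - B" "(c, d) \<in> parcs G"
    using conn y(1) unfolding connected_iff_cut by blast
  \<comment> \<open>If \<open>c\<close> were \<open>x\<close> or a neighbour of \<open>x\<close>,
    then \<open>d\<close> would lie in the ball \<open>B\<close>; so \<open>c\<close> has distance
    exactly 2 from \<open>x\<close>.\<close>
  have c: "c \<noteq> x" "(x, c) \<notin> parcs G"
    using cd by (auto simp: B_def)
  then obtain b where b: "(x, b) \<in> parcs G" "(b, c) \<in> parcs G"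
    using cd(1) by (auto simp: B_def)
  have "(x, d) \<notin> parcs G" "(b, d) \<notin> parcs G" "x \<noteq> d" "b \<noteq> d"
    using cd b by (auto simp: B_def)
  then have "is_induced_subgraph_of (path_graph 4) G"
    using b cd(3) c by (intro path_graph_4_induced[of x b c d]) auto
  with free show False by (simp add: induced_free_def)
qed

lemma (in pair_graph) P4_free_edge_connectivity:
  assumes conn: "connected (with_proj G)" and free: "induced_free (path_graph 4) G"
  shows "edge_connectivity G = min_degree G"
proof -
  have ne: "pverts G \<noteq> {}" using conn connected_iff_cut by blast
  have "min_degree G \<le> edge_connectivity G"
  proof (cases "card (pverts G) \<le> 1")
    \<comment> \<open>For a single vertex the minimum degree is 0, which agrees with the
      conventional edge-connectivity.\<close>
    case True
    then have "card (pverts G) = 1"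
      using ne pair_finite_verts by (metis One_nat_def Suc_leI card_gt_0_iff le_antisym)
    then obtain x where x: "pverts G = {x}" by (rule card_1_singletonE)
    have "{v. (x, v) \<in> parcs G} = {}"
      using x no_loops'[of x] in_arcsD2[of x] by auto
    then show ?thesis
      using x by (simp add: min_degree_def out_degree_eq_card_neighbours)
  next
    case False
    then have "1 < card (pverts G)" by simp
    then obtain F A where F: "F \<subseteq> uedges G" "edge_connectivity G = card F"
      and A: "A \<subseteq> pverts G" "A \<noteq> {}" "A \<noteq> pverts G"
      and cut: "\<And>a b. a \<in> A \<Longrightarrow> b \<in> pverts G - A \<Longrightarrow> (a, b) \<in> parcs G \<Longrightarrow> {a, b} \<in> F"
      by (rule edge_connectivity_witness) blast
    have "finite F" using F finite_uedges finite_subset by blast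
    have "\<exists>x\<in>pverts G. out_degree (with_proj G) x \<le> card F"
    proof (cases "\<forall>a\<in>A. \<exists>b\<in>pverts G - A. (a, b) \<in> parcs G")
      case True
      obtain x where x: "x \<in> A" using A by blast
      have "out_degree (with_proj G) x \<le> card F"
        using out_degree_le_card_cut[OF \<open>finite F\<close> x A(1)] cut True by simp
      then show ?thesis using x A by blast
    next
      case False
      then obtain x where x: "x \<in> A" "\<And>b. b \<in> pverts G - A \<Longrightarrow> (x, b) \<notin> parcs G" by blast
      let ?A' = "pverts G - A"
      \<comment> \<open>The vertex \<open>x\<close> has all its neighbours in \<open>A\<close>, so
        it is not adjacent to \<open>a\<close>. Their common neighbour then lies in
        \<open>A\<close>, which makes \<open>a\<close> an end of a cut edge.\<close>
      have nb: "\<exists>b\<in>pverts G - ?A'. (a, b) \<in> parcs G" if a: "a \<in> ?A'" for a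
      proof -
        obtain z where z: "(x, z) \<in> parcs G" "(z, a) \<in> parcs G"
          using P4_free_common_neighbour[OF conn free, of x a] a x A by blast
        then have "z \<in> pverts G - ?A'" using x wellformed' by blast
        then show ?thesis using z arc_sym by blast
      qed
      have cut': "{a, b} \<in> F" if "a \<in> ?A'" "b \<in> pverts G - ?A'" "(a, b) \<in> parcs G" for a b
        using cut[of b a] that arc_sym[OF that(3)] by (auto simp: insert_commute)
      obtain y where y: "y \<in> ?A'" using A by blast
      have "out_degree (with_proj G) y \<le> card F"
        using out_degree_le_card_cut[OF \<open>finite F\<close> y Diff_subset] cut' nb by simp
      then show ?thesis using y by blast
    qed
    moreover have "min_degree G \<le> out_degree (with_proj G) x" if "x \<in> pverts G" for x
      unfolding min_degree_def using that pair_finite_verts by simp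
    ultimately show ?thesis using F(2) order_trans by metis
  qed
  with edge_connectivity_le_min_degree[OF ne] show ?thesis by simp
qed

section \<open>Two cycles joined by a bridge\<close>

text \<open>The bridge is the consecutive pair \<open>n - 1, n\<close>; the two extra edges close up the cycles.\<close>
definition bridged_cycles :: "nat \<Rightarrow> nat pair_pre_digraph" where
  "bridged_cycles n =
    \<lparr> pverts = {..<2 * n},
      parcs = {(i, j). i < 2 * n \<and> j < 2 * n \<and>
        (j = Suc i \<or> i = Suc j \<or> {i, j} = {0, n - 1} \<or> {i, j} = {n, 2 * n - 1})} \<rparr>"

section \<open>Copies of a graph along an injection\<close>

text \<open>The counterexamples live on \<open>nat\<close>, while the theorem quantifies over graphs
  on an arbitrary infinite type; this transports them there.\<close>

definition map_graph :: "('a \<Rightarrow> 'b) \<Rightarrow> 'a pair_pre_digraph \<Rightarrow> 'b pair_pre_digraph" where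
  "map_graph h G = \<lparr> pverts = h ` pverts G, parcs = map_prod h h ` parcs G \<rparr>"

lemma map_graph_arc_iff: "inj h \<Longrightarrow> (h u, h v) \<in> parcs (map_graph h G) \<longleftrightarrow> (u, v) \<in> parcs G"
  by (auto simp: map_graph_def dest: injD)

lemma pair_graph_map_graph:
  assumes "pair_graph G" "inj h"
  shows "pair_graph (map_graph h G)"
proof -
  interpret pair_graph G by (rule assms)
  show ?thesis
    using pair_finite_verts pair_finite_arcs assms(2)
    by unfold_locales
      (auto simp: map_graph_def symmetric_def sym_def inj_eq dest: wellformed' no_loops' intro: arc_sym)
qed

lemma map_graph_induced_subgraph:
  assumes "pair_graph G" "inj h"
  shows "is_induced_subgraph_of (map_graph h G) G"
  unfolding is_induced_subgraph_of_iff[OF pair_graph_map_graph[OF assms] assms(1)]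
  using assms(2) by (intro exI[of _ "inv h"]) (auto simp: map_graph_def inj_on_def dest: injD)

section \<open>Connectedness, edge-connectivity and minimum degree of the bridged cycles\<close>

lemma pair_graph_bridged_cycles:
  assumes "n \<ge> 2"
  shows "pair_graph (bridged_cycles n)"
proof -
  have "finite (parcs (bridged_cycles n))"
    by (rule finite_subset[of _ "{..<2 * n} \<times> {..<2 * n}"]) (auto simp: bridged_cycles_def)
  then show ?thesis
    using assms
    by unfold_locales (auto simp: bridged_cycles_def symmetric_def sym_def insert_commute doubleton_eq_iff)
qed

text \<open>Consecutive numbers are adjacent, so a set that no arc leaves contains the images of all
  numbers below \<open>2 * n\<close> or of none.\<close>

lemma connected_map_bridged_cycles:
  assumes n: "n \<ge> 2" and h: "inj h"
  shows "connected (with_proj (map_graph h (bridged_cycles n)))"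
proof -
  interpret G: pair_graph "map_graph h (bridged_cycles n)"
    using pair_graph_map_graph pair_graph_bridged_cycles assms by blast
  have V: "pverts (map_graph h (bridged_cycles n)) = h ` {..<2 * n}"
    by (simp add: map_graph_def bridged_cycles_def)
  have step: "(h i, h (Suc i)) \<in> parcs (map_graph h (bridged_cycles n))" if "Suc i < 2 * n" for i
    using that by (simp add: map_graph_arc_iff[OF h] bridged_cycles_def)
  have "\<exists>a\<in>A. \<exists>b\<in>h ` {..<2 * n} - A. (a, b) \<in> parcs (map_graph h (bridged_cycles n))"
    if A: "A \<subseteq> h ` {..<2 * n}" "A \<noteq> {}" "A \<noteq> h ` {..<2 * n}" for A
  proof (rule ccontr)
    assume none: "\<not> ?thesis"
    have iff: "h (Suc i) \<in> A \<longleftrightarrow> h i \<in> A" if "Suc i < 2 * n" for i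
    proof -
      have "h i \<in> h ` {..<2 * n}" "h (Suc i) \<in> h ` {..<2 * n}" using that by auto
      then show ?thesis using none step[OF that] G.arc_sym by blast
    qed
    have "h i \<in> A \<longleftrightarrow> h 0 \<in> A" if "i < 2 * n" for i
      using that by (induction i) (use iff in auto)
    then show False using A by blast
  qed
  then show ?thesis
    unfolding G.connected_iff_cut V using n by (auto simp: lessThan_empty_iff)
qed

text \<open>The cut separates the first \<open>n\<close> numbers from the rest. Both closing edges
  stay within one half, so only the bridge crosses.\<close>

lemma edge_connectivity_map_bridged_cycles:
  assumes n: "n \<ge> 2" and h: "inj h"
  shows "edge_connectivity (map_graph h (bridged_cycles n)) \<le> 1"
proof -
  let ?G = "map_graph h (bridged_cycles n)"
  interpret G: pair_graph ?G
    using pair_graph_map_graph pair_graph_bridged_cycles assms by blast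
  have V: "pverts ?G = h ` {..<2 * n}"
    by (simp add: map_graph_def bridged_cycles_def)
  have "edge_connectivity ?G \<le> card {{h (n - 1), h n}}"
  proof (rule G.edge_connectivity_le[where A = "h ` {..<n}"])
    show "{{h (n - 1), h n}} \<subseteq> uedges ?G"
    proof -
      have "(n - 1, n) \<in> parcs (bridged_cycles n)" using n by (simp add: bridged_cycles_def)
      then show ?thesis by (simp add: G.doubleton_in_uedges_iff map_graph_arc_iff[OF h])
    qed
    show "h ` {..<n} \<subseteq> pverts ?G" "h ` {..<n} \<noteq> {}"
      using n by (auto simp: V lessThan_empty_iff)
    show "h ` {..<n} \<noteq> pverts ?G"
      unfolding V inj_image_eq_iff[OF h] using n by (simp add: lessThan_eq_iff)
    fix a b assume a: "a \<in> h ` {..<n}" and b: "b \<in> pverts ?G - h ` {..<n}" and ab: "(a, b) \<in> parcs ?G"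
    obtain i j where ij: "a = h i" "b = h j" "i < n" "j \<ge> n" "j < 2 * n"
      using a b unfolding V by (auto simp: inj_image_mem_iff[OF h])
    then have "(i, j) \<in> parcs (bridged_cycles n)" using ab map_graph_arc_iff[OF h] by metis
    then have "i = n - 1" "j = n" using ij n
      by (auto simp: bridged_cycles_def doubleton_eq_iff)
    then show "{a, b} \<in> {{h (n - 1), h n}}" using ij by simp
  qed
  then show ?thesis by simp
qed

lemma min_degree_map_bridged_cycles:
  assumes n: "n \<ge> 3" and h: "inj h"
  shows "min_degree (map_graph h (bridged_cycles n)) \<ge> 2"
proof -
  let ?G = "map_graph h (bridged_cycles n)"
  interpret G: pair_graph ?G
    using n h by (intro pair_graph_map_graph pair_graph_bridged_cycles) simp_all
  have V: "pverts ?G = h ` {..<2 * n}"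
    by (simp add: map_graph_def bridged_cycles_def)
  have "2 \<le> out_degree (with_proj ?G) (h i)" if i: "i < 2 * n" for i
  proof -
    \<comment> \<open>\<open>p\<close> and \<open>s\<close> are the two neighbours of
      \<open>i\<close> on its own cycle. They are distinct because the cycle has at least 3
      vertices; for \<open>n = 2\<close> they would coincide.\<close>
    define p where "p = (if i = 0 then n - 1 else if i = n then 2 * n - 1 else i - 1)"
    define s where "s = (if i = n - 1 then 0 else if i = 2 * n - 1 then n else Suc i)"
    have "(i, p) \<in> parcs (bridged_cycles n)" "(i, s) \<in> parcs (bridged_cycles n)" "p \<noteq> s"
      using i n by (auto simp: bridged_cycles_def p_def s_def insert_commute)
    then have "{h p, h s} \<subseteq> {v. (h i, v) \<in> parcs ?G}" "card {h p, h s} = 2"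
      using map_graph_arc_iff[OF h] inj_eq[OF h] by auto
    then show ?thesis
      unfolding out_degree_eq_card_neighbours using card_mono[OF G.finite_neighbours] by metis
  qed
  then show ?thesis
    unfolding min_degree_def using G.pair_finite_verts n by (subst Min_ge_iff) (auto simp: V lessThan_empty_iff)
qed

section \<open>Connected graphs that embed into both bridged graphs\<close>

text \<open>The copy of the bridged cycles has \<kappa>' at most 1 and \<delta> at least 2, so by
  \<open>all\<close> it cannot be \<open>S\<close>-free.\<close>

lemma induced_in_bridged_cycles:
  fixes S :: "'a pair_pre_digraph"
  assumes S: "pair_graph S" and n: "n \<ge> 3"
    and all: "\<forall>G :: ('b :: infinite) pair_pre_digraph.
      pair_graph G \<and> connected (with_proj G) \<and> induced_free S G
        \<longrightarrow> edge_connectivity G = min_degree G"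
  shows "is_induced_subgraph_of S (bridged_cycles n)"
proof -
  obtain h :: "nat \<Rightarrow> 'b" where h: "inj h"
    using infinite_countable_subset[OF infinite_UNIV] by blast
  let ?G = "map_graph h (bridged_cycles n)"
  have B: "pair_graph (bridged_cycles n)" using n by (simp add: pair_graph_bridged_cycles)
  have G: "pair_graph ?G" by (rule pair_graph_map_graph[OF B h])
  have "edge_connectivity ?G \<noteq> min_degree ?G"
    using edge_connectivity_map_bridged_cycles[of n h] min_degree_map_bridged_cycles[of n h] n h by simp
  then have "is_induced_subgraph_of S ?G"
    using all G connected_map_bridged_cycles[of n h] n h by (auto simp: induced_free_def)
  then show ?thesis
    using is_induced_subgraph_of_trans[OF S G B] map_graph_induced_subgraph[OF B h] by blast
qed

text \<open>Parity is a 2-colouring: consecutive numbers differ in parity, and so do the ends of the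
  closing edges 0, 3 and 4, 7. An odd cycle is therefore impossible.\<close>

lemma triangle_free_if_induced_in_bridged_4_cycles:
  assumes S: "pair_graph S" and emb: "is_induced_subgraph_of S (bridged_cycles 4)"
    and "(u, v) \<in> parcs S" "(v, w) \<in> parcs S" "(u, w) \<in> parcs S"
  shows False
proof -
  interpret S: pair_graph S by (rule S)
  obtain f where f: "\<forall>u\<in>pverts S. \<forall>v\<in>pverts S. (u, v) \<in> parcs S \<longleftrightarrow> (f u, f v) \<in> parcs (bridged_cycles 4)"
    using emb S pair_graph_bridged_cycles[of 4] by (auto simp: is_induced_subgraph_of_iff)
  have bip: "even i \<noteq> even j" if "(i, j) \<in> parcs (bridged_cycles 4)" for i j
    using that by (auto simp: bridged_cycles_def doubleton_eq_iff)
  have "even (f u) \<noteq> even (f v)" "even (f v) \<noteq> even (f w)" "even (f u) \<noteq> even (f w)"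
    using assms(3-5) f S.wellformed' by (blast intro!: bip)+
  then show False by blast
qed

text \<open>The image \<open>U\<close> of \<open>S\<close> misses a vertex of each triangle. It is
  either the edge 0, 1 or the edge 4, 5, or it has at most one vertex of each of these pairs and so
  lies on a path through the bridge 2, 3.\<close>

lemma triangle_free_induced_in_bridged_3_cycles:
  assumes S: "pair_graph S" and conn: "connected (with_proj S)"
    and emb: "is_induced_subgraph_of S (bridged_cycles 3)"
    and tf: "\<And>u v w. (u, v) \<in> parcs S \<Longrightarrow> (v, w) \<in> parcs S \<Longrightarrow> (u, w) \<in> parcs S \<Longrightarrow> False"
  shows "is_induced_subgraph_of S (path_graph 4)"
proof -
  interpret S: pair_graph S by (rule S)
  obtain f where inj: "inj_on f (pverts S)" and ran: "f ` pverts S \<subseteq> pverts (bridged_cycles 3)"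
    and adj: "\<And>u v. u \<in> pverts S \<Longrightarrow> v \<in> pverts S \<Longrightarrow>
      (u, v) \<in> parcs S \<longleftrightarrow> (f u, f v) \<in> parcs (bridged_cycles 3)"
    using emb S pair_graph_bridged_cycles[of 3] by (auto simp: is_induced_subgraph_of_iff)
  define U where "U = f ` pverts S"
  have six: "{..<6::nat} = {0, 1, 2, 3, 4, 5}" by auto
  have U: "U \<subseteq> {0, 1, 2, 3, 4, 5}"
    using ran by (auto simp: U_def bridged_cycles_def six)
  have arcs: "parcs (bridged_cycles 3) =
    {(0,1), (1,0), (1,2), (2,1), (0,2), (2,0), (2,3), (3,2), (3,4), (4,3), (4,5), (5,4), (3,5), (5,3)}"
    (is "_ = ?E")
  proof (intro equalityI subrelI)
    fix i j assume ij: "(i, j) \<in> parcs (bridged_cycles 3)"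
    then have "i < 6" "j < 6"
      by (simp_all add: bridged_cycles_def)
    then have "i \<in> {0, 1, 2, 3, 4, 5}" "j \<in> {0, 1, 2, 3, 4, 5}"
      unfolding six[symmetric] by simp_all
    then show "(i, j) \<in> ?E"
      using ij by (elim insertE emptyE) (simp_all add: bridged_cycles_def doubleton_eq_iff)
  next
    fix i j assume "(i, j) \<in> ?E"
    then show "(i, j) \<in> parcs (bridged_cycles 3)"
      by (elim insertE emptyE) (simp_all add: bridged_cycles_def doubleton_eq_iff)
  qed
  have tri: False if "i \<in> U" "j \<in> U" "k \<in> U"
    "(i, j) \<in> parcs (bridged_cycles 3)" "(j, k) \<in> parcs (bridged_cycles 3)"
    "(i, k) \<in> parcs (bridged_cycles 3)" for i j k
  proof -
    obtain a b c where "a \<in> pverts S" "b \<in> pverts S" "c \<in> pverts S" "i = f a" "j = f b" "k = f c"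
      using \<open>i \<in> U\<close> \<open>j \<in> U\<close> \<open>k \<in> U\<close> unfolding U_def by blast
    then show False
      using that(4-6) tf[of a b c] adj by simp
  qed
  have not3: "\<not> (0 \<in> U \<and> 1 \<in> U \<and> 2 \<in> U)" "\<not> (3 \<in> U \<and> 4 \<in> U \<and> 5 \<in> U)"
    using tri[of 0 1 2] tri[of 3 4 5] by (auto simp: arcs)
  \<comment> \<open>Connectedness of \<open>S\<close> is carried over to the subgraph induced by
    \<open>U\<close>, where it excludes concrete sets \<open>C\<close>.\<close>
  have cut: "\<exists>i\<in>C. \<exists>j\<in>U - C. (i, j) \<in> parcs (bridged_cycles 3)"
    if C: "C \<subseteq> U" "C \<noteq> {}" "C \<noteq> U" for C
  proof -
    let ?A = "{u \<in> pverts S. f u \<in> C}"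
    have "?A \<subseteq> pverts S" "?A \<noteq> {}" "?A \<noteq> pverts S"
      using C unfolding U_def by blast+
    then obtain a b where "a \<in> ?A" "b \<in> pverts S - ?A" "(a, b) \<in> parcs S"
      using conn unfolding S.connected_iff_cut by blast
    then have "f a \<in> C" "f b \<in> U - C" "(f a, f b) \<in> parcs (bridged_cycles 3)"
      using adj by (auto simp: U_def)
    then show ?thesis by blast
  qed
  \<comment> \<open>It remains to assign positions on P4 to the vertices in \<open>U\<close>, with
    adjacency meaning consecutive positions.\<close>
  have suff: ?thesis if g: "inj_on g U" "g ` U \<subseteq> {..<4}"
    "\<And>i j. i \<in> U \<Longrightarrow> j \<in> U \<Longrightarrow> (i, j) \<in> parcs (bridged_cycles 3) \<longleftrightarrow> g j = Suc (g i) \<or> g i = Suc (g j)"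
    for g
  proof -
    have "inj_on (g \<circ> f) (pverts S)"
      using inj g(1) by (simp add: U_def comp_inj_on)
    moreover have "(g \<circ> f) ` pverts S \<subseteq> pverts (path_graph 4)"
      using g(2) by (auto simp: U_def path_graph_def)
    moreover have "\<forall>u\<in>pverts S. \<forall>v\<in>pverts S.
        (u, v) \<in> parcs S \<longleftrightarrow> ((g \<circ> f) u, (g \<circ> f) v) \<in> parcs (path_graph 4)"
      using g(2,3) adj by (auto simp: U_def path_graph_def image_subset_iff)
    ultimately show ?thesis
      using is_induced_subgraph_of_iff[OF S pair_graph_path_graph] by blast
  qed
  consider (l) "0 \<in> U" "1 \<in> U" | (r) "4 \<in> U" "5 \<in> U"
    | (m) "\<not> (0 \<in> U \<and> 1 \<in> U)" "\<not> (4 \<in> U \<and> 5 \<in> U)" by blast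
  then show ?thesis
  proof cases
    case l
    \<comment> \<open>By \<open>not3\<close> the vertex 2 is missing, and it is the only vertex
      through which an arc can leave 0, 1.\<close>
    then have "U = {0, 1}"
      using not3 cut[of "{0, 1}"] by (auto simp: arcs)
    then show ?thesis by (intro suff[of id]) (auto simp: arcs)
  next
    case r
    then have "U = {4, 5}"
      using not3 cut[of "{4, 5}"] by (auto simp: arcs)
    then show ?thesis by (intro suff[of "\<lambda>i. if i = 4 then 0 else 1"]) (auto simp: arcs)
  next
    case m
    \<comment> \<open>The positions identify 0 with 1 and 4 with 5; in this case \<open>U\<close>
      contains at most one vertex of each pair, so \<open>?g\<close> is injective on it.\<close>
    let ?g = "(!) [0, 0, 1, 2, 3, 3::nat]"
    have mem: "i = 0 \<or> i = 1 \<or> i = 2 \<or> i = 3 \<or> i = 4 \<or> i = 5" if "i \<in> U" for i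
      using that U by blast
    have "inj_on ?g U"
    proof (rule inj_onI)
      fix i j assume ij: "i \<in> U" "j \<in> U" and "?g i = ?g j"
      then show "i = j"
        using mem[OF ij(1)] mem[OF ij(2)] m by (elim disjE) simp_all
    qed
    moreover have "?g ` U \<subseteq> {..<4}"
      by (auto dest!: mem)
    moreover have "(i, j) \<in> parcs (bridged_cycles 3) \<longleftrightarrow> ?g j = Suc (?g i) \<or> ?g i = Suc (?g j)"
      if "i \<in> U" "j \<in> U" for i j
      using mem[OF that(1)] mem[OF that(2)] that m by (elim disjE) (simp_all add: arcs)
    ultimately show ?thesis by (intro suff[of ?g])
  qed
qed

theorem theorem1p4:
  fixes S :: "'a pair_pre_digraph"
  assumes "pair_graph S" and "connected (with_proj S)"
  shows "(\<forall>G :: ('b :: infinite) pair_pre_digraph.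
            pair_graph G \<and> connected (with_proj G) \<and> induced_free S G
              \<longrightarrow> edge_connectivity G = min_degree G)
         \<longleftrightarrow> is_induced_subgraph_of S (path_graph 4)"
proof
  assume all: "\<forall>G :: 'b pair_pre_digraph. pair_graph G \<and> connected (with_proj G) \<and> induced_free S G
    \<longrightarrow> edge_connectivity G = min_degree G"
  \<comment> \<open>The 4-cycles exclude triangles from \<open>S\<close>; the 3-cycles then leave
    only subgraphs of P4.\<close>
  have "is_induced_subgraph_of S (bridged_cycles 3)" "is_induced_subgraph_of S (bridged_cycles 4)"
    using induced_in_bridged_cycles[OF assms(1) _ all] by simp_all
  then show "is_induced_subgraph_of S (path_graph 4)"
    using triangle_free_induced_in_bridged_3_cycles[OF assms]
      triangle_free_if_induced_in_bridged_4_cycles[OF assms(1)] by blast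
next
  assume emb: "is_induced_subgraph_of S (path_graph 4)"
  show "\<forall>G :: 'b pair_pre_digraph. pair_graph G \<and> connected (with_proj G) \<and> induced_free S G
    \<longrightarrow> edge_connectivity G = min_degree G"
  proof (intro allI impI, elim conjE)
    fix G :: "'b pair_pre_digraph"
    assume G: "pair_graph G" "connected (with_proj G)" "induced_free S G"
    \<comment> \<open>An induced P4 in \<open>G\<close> would contain an induced copy of
      \<open>S\<close>.\<close>
    then have "induced_free (path_graph 4) G"
      using is_induced_subgraph_of_trans[OF assms(1) pair_graph_path_graph G(1) emb]
      by (auto simp: induced_free_def)
    then show "edge_connectivity G = min_degree G"
      using pair_graph.P4_free_edge_connectivity G by blast
  qed
qed

end
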